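(* Let $\kappa$ be an infinite cardinal and let $\lambda=(2^\kappa)^+$. Then every abelian group $G$ of cardinality $\lambda$ satisfies $G\rightarrow(\kappa\times 2)^{\mathrm{FS}_{\mathrm{matrix}}}_\kappa$; that is, for every colouring $c:G\to\kappa$ there is a family $(x_{\alpha,i}\mid \alpha<\kappa,\ i<2)$ of pairwise distinct elements of $G$ such that $c$ is constant on the set $$\mathrm{FS}_{\mathrm{matrix}}(x_{\alpha,i}\mid\alpha<\kappa,\ i<2)=\{x_{\alpha,0}\mid\alpha<\kappa\}\cup\{x_{\alpha,1}\mid\alpha<\kappa\}\cup\{x_{\alpha,0}+x_{\beta,1}\mid\alpha,\beta<\kappa\}.$$
   Context: In general, for a $\kappa\times n$ matrix $(x_{\alpha,i}\mid\alpha<\kappa, i<n)$ of elements of an abelian group, $\mathrm{FS}_{\mathrm{matrix}}$ is the set of all sums $x_{\alpha_1,i_1}+\cdots+x_{\alpha_k,i_k}$ with $k\ge 1$, $i_1<\cdots<i_k<n$ and $\alpha_1,\ldots,\alpha_k<\kappa$; for $n=2$ this is the set displayed in the claim. $(2^\kappa)^+$ denotes the successor cardinal of $2^\kappa$. *)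

theory Defs
  imports "HOL-Algebra.FiniteProduct"
begin

unbundle cardinal_syntax

(* A cardinal is a Card_order 'k rel, and the ordinals below it are the elements of its
   field.  Abelian groups are written multiplicatively (comm_group), so the sums of the
   usual additive notation are products here.  Over a commutative group, a choice of
   i_1 < ... < i_k < n with k >= 1 is a nonempty subset I of {..<n}. *)

definition FS_matrix ::
  "('g, 'm) monoid_scheme \<Rightarrow> 'a rel \<Rightarrow> nat \<Rightarrow> ('a \<Rightarrow> nat \<Rightarrow> 'g) \<Rightarrow> 'g set"
  where "FS_matrix G \<kappa> n x =
    {finprod G (\<lambda>i. x (\<alpha> i) i) I | I \<alpha>. I \<noteq> {} \<and> I \<subseteq> {..<n} \<and> \<alpha> ` I \<subseteq> Field \<kappa>}"

(* The relation G \<rightarrow> (\<kappa> \<times> n)_\<theta> for FS_matrix. *)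
definition FS_matrix_arrow ::
  "('g, 'm) monoid_scheme \<Rightarrow> 'a rel \<Rightarrow> nat \<Rightarrow> 'c rel \<Rightarrow> bool"
  where "FS_matrix_arrow G \<kappa> n \<theta> \<longleftrightarrow>
    (\<forall>c \<in> carrier G \<rightarrow> Field \<theta>.
      \<exists>x. (\<forall>\<alpha>\<in>Field \<kappa>. \<forall>i<n. x \<alpha> i \<in> carrier G) \<and>
          inj_on (\<lambda>(\<alpha>, i). x \<alpha> i) (Field \<kappa> \<times> {..<n}) \<and>
          (\<exists>j\<in>Field \<theta>. \<forall>s\<in>FS_matrix G \<kappa> n x. c s = j))"

lemma FS_matrix_two:
  assumes "comm_group G" and x: "\<forall>\<alpha>\<in>Field \<kappa>. \<forall>i<2. x \<alpha> i \<in> carrier G"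
  shows "FS_matrix G \<kappa> 2 x =
    {x \<alpha> 0 | \<alpha>. \<alpha> \<in> Field \<kappa>} \<union> {x \<alpha> 1 | \<alpha>. \<alpha> \<in> Field \<kappa>} \<union>
    {x \<alpha> 0 \<otimes>\<^bsub>G\<^esub> x \<beta> 1 | \<alpha> \<beta>. \<alpha> \<in> Field \<kappa> \<and> \<beta> \<in> Field \<kappa>}" (is "?L = ?R")
proof -
  interpret comm_group G by fact
  have x0: "x \<alpha> 0 \<in> carrier G" and x1: "x \<alpha> (Suc 0) \<in> carrier G" if "\<alpha> \<in> Field \<kappa>" for \<alpha>
    using x that by auto
  have fp0: "finprod G (\<lambda>i. x (a i) i) {0} = x (a 0) 0" if "a 0 \<in> Field \<kappa>" for a
    using x0 that by (subst finprod_insert) auto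
  have fp1: "finprod G (\<lambda>i. x (a i) i) {1} = x (a 1) 1" if "a 1 \<in> Field \<kappa>" for a
    using x1 that by (subst finprod_insert) auto
  have fp2: "finprod G (\<lambda>i. x (a i) i) {0, 1} = x (a 0) 0 \<otimes>\<^bsub>G\<^esub> x (a 1) 1"
    if "a 0 \<in> Field \<kappa>" "a 1 \<in> Field \<kappa>" for a
    using x0 x1 that by (subst finprod_insert) auto
  have two: "{..<2::nat} = {0, 1}" by auto
  show ?thesis
  proof
    show "?L \<subseteq> ?R"
    proof
      fix s assume "s \<in> ?L"
      then obtain I a where I: "I \<noteq> {}" "I \<subseteq> {0, 1}" and a: "a ` I \<subseteq> Field \<kappa>"
        and s: "s = finprod G (\<lambda>i. x (a i) i) I"
        unfolding FS_matrix_def two by blast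
      from I consider "I = {0}" | "I = {1}" | "I = {0, 1}" by auto
      then show "s \<in> ?R"
      proof cases
        case 1
        then have "a 0 \<in> Field \<kappa>" using a by auto
        then show ?thesis using s fp0 1 by auto
      next
        case 2
        then have "a 1 \<in> Field \<kappa>" using a by auto
        then show ?thesis using s fp1 2 by auto
      next
        case 3
        then have "a 0 \<in> Field \<kappa>" "a 1 \<in> Field \<kappa>" using a by auto
        then show ?thesis using s fp2 3 by blast
      qed
    qed
    show "?R \<subseteq> ?L"
    proof
      fix s assume "s \<in> ?R"
      then consider a where "a \<in> Field \<kappa>" "s = x a 0" | a where "a \<in> Field \<kappa>" "s = x a 1"
        | a b where "a \<in> Field \<kappa>" "b \<in> Field \<kappa>" "s = x a 0 \<otimes>\<^bsub>G\<^esub> x b 1" by blast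
      then show "s \<in> ?L"
      proof cases
        case (1 a)
        then show ?thesis using fp0[of "\<lambda>_. a"] unfolding FS_matrix_def two
          by (intro CollectI exI[of _ "{0}"] exI[of _ "\<lambda>_. a"]) auto
      next
        case (2 a)
        then show ?thesis using fp1[of "\<lambda>_. a"] unfolding FS_matrix_def two
          by (intro CollectI exI[of _ "{1}"] exI[of _ "\<lambda>_. a"]) auto
      next
        case (3 a b)
        then show ?thesis using fp2[of "\<lambda>i. if i = 0 then a else b"] unfolding FS_matrix_def two
          by (intro CollectI exI[of _ "{0,1}"] exI[of _ "\<lambda>i. if i = 0 then a else b"]) auto
      qed
    qed
  qed
qed

end

theory Submission
  imports Defs
begin

text \<open>Colour a pair \<open>h < g\<close> of a well-ordering of \<open>G\<close> by \<open>c (g - h)\<close>. The Erdos--Rado theorem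
  gives a homogeneous set \<open>H\<close> with more than \<open>\<kappa>\<close> elements. Pick \<open>d \<in> H\<close> with exactly \<open>\<kappa>\<close> elements
  \<open>a\<close> of \<open>H\<close> below it; more than \<open>\<kappa>\<close> elements \<open>b\<close> of \<open>H\<close> lie above. The telescoping identity
  \<open>(d - a) + (b - d) = b - a\<close> shows that the elements \<open>d - a\<close> form one column of the required
  matrix, and those \<open>b - d\<close> which are not of the form \<open>d - a\<close> provide the other.

  The homogeneous set comes from the ramification tree: \<open>h\<close> lies below \<open>g\<close> in the tree if
  \<open>h < g\<close> and every \<open>k\<close> below \<open>h\<close> in the tree has the same colour with \<open>h\<close> as with \<open>g\<close>. An
  element is determined by its branch together with the colours along it, so if all branches had
  at most \<open>\<kappa>\<close> elements then there would be at most \<open>2\<^sup>\<kappa>\<close> elements altogether. On a branch with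
  more than \<open>\<kappa>\<close> elements, more than \<open>\<kappa>\<close> have the same colour with its top, and these are homogeneous.\<close>

section \<open>The ramification tree of a pair colouring on a well-order\<close>

definition tree_above :: "'a rel \<Rightarrow> ('a \<Rightarrow> 'a \<Rightarrow> 'c) \<Rightarrow> 'a \<Rightarrow> 'a set" where
  "tree_above r f = wfrec (r - Id)
    (\<lambda>S h. {g. (h, g) \<in> r - Id \<and> (\<forall>k. (k, h) \<in> r - Id \<and> h \<in> S k \<longrightarrow> f k h = f k g)})"

definition branch :: "'a rel \<Rightarrow> ('a \<Rightarrow> 'a \<Rightarrow> 'c) \<Rightarrow> 'a \<Rightarrow> 'a set" where
  "branch r f g = {h. g \<in> tree_above r f h}"

context
  fixes r :: "'a rel" and f :: "'a \<Rightarrow> 'a \<Rightarrow> 'c"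
  assumes r: "Well_order r"
begin

lemma wf_strict: "wf (r - Id)"
  using r by (simp add: well_order_on_def)

lemma strict_trans: "(x, y) \<in> r - Id \<Longrightarrow> (y, z) \<in> r - Id \<Longrightarrow> (x, z) \<in> r - Id"
  using r unfolding order_on_defs trans_def antisym_def by blast

lemma strict_cases:
  assumes "x \<in> Field r" "y \<in> Field r"
  obtains "x = y" | "(x, y) \<in> r - Id" | "(y, x) \<in> r - Id"
  using r assms unfolding order_on_defs total_on_def by blast

text \<open>The guard \<open>(k, h) \<in> r - Id\<close> in the recursion makes every call
  decreasing, which lets \<open>cut\<close> disappear on unfolding.\<close>

lemma tree_above_iff:
  "g \<in> tree_above r f h \<longleftrightarrow>
    (h, g) \<in> r - Id \<and> (\<forall>k. (k, h) \<in> r - Id \<and> h \<in> tree_above r f k \<longrightarrow> f k h = f k g)"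
proof -
  have "tree_above r f h = {g. (h, g) \<in> r - Id \<and>
      (\<forall>k. (k, h) \<in> r - Id \<and> h \<in> cut (tree_above r f) (r - Id) h k \<longrightarrow> f k h = f k g)}"
    unfolding tree_above_def by (subst wfrec[OF wf_strict]) (rule refl)
  then show ?thesis
    by (auto simp: cut_apply)
qed

lemma branch_iff:
  "h \<in> branch r f g \<longleftrightarrow> (h, g) \<in> r - Id \<and> (\<forall>k\<in>branch r f h. f k h = f k g)"
proof -
  have "(k, h) \<in> r - Id" if "h \<in> tree_above r f k" for k
    using that tree_above_iff[of h k] by simp
  then show ?thesis
    using tree_above_iff[of g h] unfolding branch_def by auto
qed

lemma branch_less: "h \<in> branch r f g \<Longrightarrow> (h, g) \<in> r - Id"
  using branch_iff[of h g] by blast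

lemma branch_colour: "h \<in> branch r f g \<Longrightarrow> k \<in> branch r f h \<Longrightarrow> f k h = f k g"
  using branch_iff[of h g] by blast

text \<open>Induction on the lowest element: for \<open>m\<close> below \<open>k\<close> in the
  tree, the induction hypothesis puts \<open>m\<close> below \<open>h\<close>, so that
  \<open>f m k = f m h = f m g\<close>.\<close>

lemma branch_trans:
  assumes "k \<in> branch r f h" "h \<in> branch r f g"
  shows "k \<in> branch r f g"
  using wf_strict assms
proof (induction k arbitrary: h g rule: wf_induct_rule)
  case (less k)
  have "f m k = f m g" if m: "m \<in> branch r f k" for m
  proof -
    have "m \<in> branch r f h"
      using less.IH[OF branch_less[OF m] m less.prems(1)] .
    then show ?thesis
      using branch_colour[OF less.prems(1) m] branch_colour[OF less.prems(2)] by simp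
  qed
  then show ?case
    using strict_trans[OF branch_less[OF less.prems(1)] branch_less[OF less.prems(2)]]
    by (simp add: branch_iff[of k g])
qed

text \<open>This makes branches chains of the tree. Any \<open>m\<close> below \<open>k\<close> is
  below \<open>g\<close> by transitivity and below \<open>h\<close> by induction, so
  \<open>f m k\<close> and \<open>f m h\<close> both equal \<open>f m g\<close>.\<close>

lemma branch_linear:
  assumes "k \<in> branch r f g" "h \<in> branch r f g" "(k, h) \<in> r - Id"
  shows "k \<in> branch r f h"
  using wf_strict assms
proof (induction k rule: wf_induct_rule)
  case (less k)
  have "f m k = f m h" if m: "m \<in> branch r f k" for m
  proof -
    have mg: "m \<in> branch r f g"
      using m less.prems(1) by (rule branch_trans)
    have "m \<in> branch r f h"
      using less.IH[OF branch_less[OF m] mg less.prems(2)] strict_trans[OF branch_less[OF m] less.prems(3)] .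
    then show ?thesis
      using branch_colour[OF less.prems(1) m] branch_colour[OF less.prems(2)] by simp
  qed
  then show ?case
    using less.prems(3) by (simp add: branch_iff[of k h])
qed

text \<open>If the two elements differed, the agreement of colours would put the smaller one on the
  branch of the larger, hence on its own branch, against irreflexivity.\<close>

lemma branch_determines:
  assumes "h \<in> Field r" "h' \<in> Field r" and eq: "branch r f h = branch r f h'"
    and col: "\<And>k. k \<in> branch r f h \<Longrightarrow> f k h = f k h'"
  shows "h = h'"
proof (rule strict_cases[OF assms(1,2)])
  assume "(h, h') \<in> r - Id"
  then have "h \<in> branch r f h'"
    using col by (simp add: branch_iff[of h h'])
  then show ?thesis
    using eq branch_less[of h h] by simp
next
  assume less: "(h', h) \<in> r - Id"
  have "f k h' = f k h" if "k \<in> branch r f h'" for k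
    using col[of k] that eq by simp
  then have "h' \<in> branch r f h"
    using less branch_iff[of h' h] by blast
  then show ?thesis
    using eq branch_less[of h' h'] by simp
qed

text \<open>The code is a copy of the ordered branch on the index type, decorated with the colours
  towards \<open>g\<close>. It refers to indices only, so the elements themselves have to be
  recovered, from the bottom of the branch upwards.\<close>

lemma branch_code_determines:
  fixes e :: "'a \<Rightarrow> 'a \<Rightarrow> 'k"
  defines "code \<equiv> \<lambda>g. {(e g h, e g h', f h' g) | h h'. h \<in> branch r f g \<and> h' \<in> branch r f g \<and> (h, h') \<in> r}"
  assumes inj: "\<And>g. g \<in> Field r \<Longrightarrow> inj_on (e g) (branch r f g)"
  shows "inj_on code (Field r)"
proof (rule inj_onI)
  fix g g' assume g: "g \<in> Field r" and g': "g' \<in> Field r" and eq: "code g = code g'"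
  have refl: "(h, h) \<in> r" if "h \<in> branch r f x" for h x
    using r branch_less[OF that] unfolding order_on_defs refl_on_def Field_def by blast
  have transfer: "\<exists>h2\<in>branch r f y. \<exists>k2\<in>branch r f y.
      e y h2 = e x h \<and> e y k2 = e x k \<and> (h2, k2) \<in> r \<and> f k2 y = f k x"
    if "code x = code y" "h \<in> branch r f x" "k \<in> branch r f x" "(h, k) \<in> r" for x y h k
  proof -
    have "(e x h, e x k, f k x) \<in> code x"
      using that unfolding code_def by blast
    then have "(e x h, e x k, f k x) \<in> code y"
      using that by simp
    then show ?thesis
      unfolding code_def by force
  qed
  note fwd = transfer[OF eq] and bwd = transfer[OF eq[symmetric]]
  note injg = inj_onD[OF inj[OF g]] and injg' = inj_onD[OF inj[OF g']]
  \<comment> \<open>Equal indices name equal elements although \<open>e g\<close> and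
    \<open>e g'\<close> are unrelated embeddings. By induction, \<open>h\<close> and
    \<open>h'\<close> have the same branch and the same colours along it, so
    \<open>branch_determines\<close> applies.\<close>
  have same: "h = h'"
    if "h \<in> branch r f g" "h' \<in> branch r f g'" "e g h = e g' h'" for h h'
    using wf_strict that
  proof (induction h arbitrary: h' rule: wf_induct_rule)
    case (less h)
    have sub: "k \<in> branch r f h' \<and> f k h = f k h'" if k: "k \<in> branch r f h" for k
    proof -
      have kg: "k \<in> branch r f g"
        using k less.prems(1) by (rule branch_trans)
      have kh: "(k, h) \<in> r - Id"
        using k by (rule branch_less)
      obtain k2 h2 where 2: "k2 \<in> branch r f g'" "h2 \<in> branch r f g'"
        "e g' k2 = e g k" "e g' h2 = e g h" "(k2, h2) \<in> r"
        using fwd[OF kg less.prems(1)] kh by blast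
      have "k = k2"
        using less.IH[OF kh kg 2(1)] 2(3) by simp
      moreover have "h2 = h'"
        using injg'[OF _ 2(2) less.prems(2)] 2(4) less.prems(3) by simp
      \<comment> \<open>The code stores the reflexive order only; strictness is recovered from the
        injectivity of \<open>e g\<close>.\<close>
      moreover have "k2 \<noteq> h2"
        using injg[OF _ kg less.prems(1)] 2(3,4) kh by auto
      ultimately have kh': "k \<in> branch r f h'" and kg': "k \<in> branch r f g'"
        using branch_linear[OF 2(1) less.prems(2)] 2 by auto
      \<comment> \<open>The diagonal pair \<open>(k, k)\<close> of the code carries the colour of
        \<open>k\<close>, giving \<open>f k h = f k g = f k g' = f k h'\<close>.\<close>
      obtain k3 where 3: "k3 \<in> branch r f g'" "e g' k3 = e g k" "f k3 g' = f k g"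
        using fwd[OF kg kg refl[OF kg]] by blast
      have "k = k3"
        using less.IH[OF kh kg 3(1)] 3(2) by simp
      then show ?thesis
        using 3(3) kh' branch_colour[OF less.prems(1) k] branch_colour[OF less.prems(2) kh'] by simp
    qed
    \<comment> \<open>Here \<open>h2 = h\<close> has to come first: it shows that \<open>k2\<close>
      precedes \<open>h\<close>, which makes the induction hypothesis applicable to
      \<open>k2\<close>.\<close>
    have sup: "k \<in> branch r f h" if k: "k \<in> branch r f h'" for k
    proof -
      have kg: "k \<in> branch r f g'"
        using k less.prems(2) by (rule branch_trans)
      have kh: "(k, h') \<in> r - Id"
        using k by (rule branch_less)
      obtain k2 h2 where 2: "k2 \<in> branch r f g" "h2 \<in> branch r f g"
        "e g k2 = e g' k" "e g h2 = e g' h'" "(k2, h2) \<in> r"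
        using bwd[OF kg less.prems(2)] kh by blast
      have h2: "h2 = h"
        using injg[OF _ 2(2) less.prems(1)] 2(4) less.prems(3) by simp
      moreover have "k2 \<noteq> h2"
        using injg'[OF _ kg less.prems(2)] 2(3,4) kh by auto
      ultimately have k2h: "(k2, h) \<in> r - Id"
        using 2 by auto
      then have "k2 \<in> branch r f h"
        using branch_linear[OF 2(1) less.prems(1)] by simp
      moreover have "k2 = k"
        using less.IH[OF k2h 2(1) kg] 2(3) by simp
      ultimately show ?thesis by simp
    qed
    have "h \<in> Field r" "h' \<in> Field r"
      using branch_less less.prems unfolding Field_def by blast+
    then show ?case
      using sub sup by (intro branch_determines) blast+
  qed
  have sub: "h \<in> branch r f g' \<and> f h g = f h g'" if h: "h \<in> branch r f g" for h
    using fwd[OF h h refl[OF h]] same[OF h] by metis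
  have sup: "h \<in> branch r f g" if h: "h \<in> branch r f g'" for h
    using bwd[OF h h refl[OF h]] same[OF _ h] by metis
  show "g = g'"
    using sub sup by (intro branch_determines[OF g g']) blast+
qed

end

section \<open>The Erdos-Rado theorem for pairs, and cutting a large homogeneous set\<close>

lemma not_Cinfinite_less_iff: "Cinfinite \<kappa> \<Longrightarrow> \<not> \<kappa> <o |A| \<longleftrightarrow> |A| \<le>o \<kappa>"
  by (simp add: not_ordLess_iff_ordLeq card_of_Well_order card_order_on_def)

text \<open>Otherwise each branch can be indexed by \<open>Field \<kappa>\<close>, and the codes
  embed \<open>Field r\<close> into the power set of the cube of \<open>Field \<kappa>\<close>, of
  size \<open>ctwo ^c \<kappa>\<close>.\<close>

lemma large_branch:
  fixes r :: "'a rel" and f :: "'a \<Rightarrow> 'a \<Rightarrow> 'k" and \<kappa> :: "'k rel"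
  assumes r: "Well_order r" and \<kappa>: "Cinfinite \<kappa>"
    and large: "ctwo ^c \<kappa> <o |Field r|"
    and f: "\<And>h g. h \<in> Field r \<Longrightarrow> g \<in> Field r \<Longrightarrow> f h g \<in> Field \<kappa>"
  shows "\<exists>g\<in>Field r. \<kappa> <o |branch r f g|"
proof (rule ccontr)
  assume "\<not> ?thesis"
  then have no: "\<not> \<kappa> <o |branch r f g|" if "g \<in> Field r" for g
    using that by blast
  have fld: "h \<in> Field r" if "h \<in> branch r f g" for h g
    using branch_less[OF r that] unfolding Field_def by blast
  have "|branch r f g| \<le>o |Field \<kappa>|" if "g \<in> Field r" for g
  proof -
    have "|branch r f g| \<le>o \<kappa>"
      using no[OF that] not_Cinfinite_less_iff[OF \<kappa>] by blast
    then show ?thesis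
      using ordLeq_ordIso_trans[OF _ ordIso_symmetric[OF card_of_Field_ordIso]] \<kappa> by blast
  qed
  then have "\<exists>e. inj_on e (branch r f g) \<and> e ` branch r f g \<subseteq> Field \<kappa>" if "g \<in> Field r" for g
    using that by (simp add: card_of_ordLeq)
  then obtain e where inj: "\<And>g. g \<in> Field r \<Longrightarrow> inj_on (e g) (branch r f g)"
    and into: "\<And>g. g \<in> Field r \<Longrightarrow> e g ` branch r f g \<subseteq> Field \<kappa>"
    by metis
  define code where
    "code g = {(e g h, e g h', f h' g) | h h'. h \<in> branch r f g \<and> h' \<in> branch r f g \<and> (h, h') \<in> r}" for g
  let ?K3 = "Field \<kappa> \<times> Field \<kappa> \<times> Field \<kappa>"
  have "inj_on code (Field r)"
    unfolding code_def using branch_code_determines[OF r inj] by blast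
  moreover have "code ` Field r \<subseteq> Pow ?K3"
    unfolding code_def using into f fld by blast
  ultimately have "|Field r| \<le>o |Pow ?K3|"
    using card_of_ordLeq by blast
  also have "|Pow ?K3| \<le>o |Pow (Field \<kappa>)|"
  proof -
    have inf: "infinite (Field \<kappa>)"
      using \<kappa> by (simp add: cinfinite_def)
    then have sq: "|Field \<kappa> \<times> Field \<kappa>| =o |Field \<kappa>|"
      by (rule card_of_Times_same_infinite)
    have "|?K3| =o |Field \<kappa>|"
      using inf by (intro card_of_Times_infinite_simps(1)[OF inf _ ordIso_imp_ordLeq[OF sq]]) auto
    then obtain b where "bij_betw b ?K3 (Field \<kappa>)"
      using card_of_ordIso by blast
    then show ?thesis
      by (metis bij_betw_Pow card_of_ordIso ordIso_imp_ordLeq)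
  qed
  also have "|Pow (Field \<kappa>)| =o ctwo ^c \<kappa>"
    unfolding ctwo_def cexp_def Field_card_of by (rule card_of_Pow_Func)
  finally show False
    using large not_ordLess_ordLeq by blast
qed

text \<open>By pigeonhole, some class \<open>P j\<close> of a large branch, sorted by the colour
  with its top \<open>g\<close>, is still large. For \<open>h\<close> before \<open>k\<close> in
  \<open>P j\<close>, linearity puts \<open>h\<close> on the branch of \<open>k\<close>, so
  \<open>f h k = f h g = j\<close>.\<close>

lemma Erdos_Rado_pairs:
  fixes r :: "'a rel" and f :: "'a \<Rightarrow> 'a \<Rightarrow> 'k" and \<kappa> :: "'k rel"
  assumes r: "Well_order r" and \<kappa>: "Cinfinite \<kappa>"
    and large: "ctwo ^c \<kappa> <o |Field r|"
    and f: "\<And>h g. h \<in> Field r \<Longrightarrow> g \<in> Field r \<Longrightarrow> f h g \<in> Field \<kappa>"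
  obtains H j where "H \<subseteq> Field r" "j \<in> Field \<kappa>" "\<kappa> <o |H|"
    "\<And>h g. h \<in> H \<Longrightarrow> g \<in> H \<Longrightarrow> (h, g) \<in> r - Id \<Longrightarrow> f h g = j"
proof -
  obtain g where g: "g \<in> Field r" and big: "\<kappa> <o |branch r f g|"
    using large_branch[where f = f, OF assms] by blast
  define P where "P j = {h \<in> branch r f g. f h g = j}" for j
  have fld: "h \<in> Field r" if "h \<in> branch r f g" for h
    using branch_less[OF r that] unfolding Field_def by blast
  have "\<exists>j\<in>Field \<kappa>. \<kappa> <o |P j|"
  proof (rule ccontr)
    assume "\<not> ?thesis"
    then have "|P j| \<le>o \<kappa>" if "j \<in> Field \<kappa>" for j
      using that not_Cinfinite_less_iff[OF \<kappa>] by blast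
    then have "|\<Union>j\<in>Field \<kappa>. P j| \<le>o \<kappa>"
      using \<kappa> card_of_Field_ordIso[THEN ordIso_imp_ordLeq] by (intro UNION_Cinfinite_bound) auto
    moreover have "(\<Union>j\<in>Field \<kappa>. P j) = branch r f g"
      unfolding P_def using f fld g by blast
    ultimately show False
      using big not_ordLess_ordLeq[OF big] by simp
  qed
  then obtain j where j: "j \<in> Field \<kappa>" "\<kappa> <o |P j|" by blast
  show thesis
  proof (rule that[OF _ j])
    show "P j \<subseteq> Field r"
      unfolding P_def using fld by blast
    fix h k assume hk: "h \<in> P j" "k \<in> P j" "(h, k) \<in> r - Id"
    then have "h \<in> branch r f k"
      unfolding P_def using branch_linear[OF r] by blast
    then have "f h k = f h g"
      using hk(2) by (intro branch_colour[OF r]) (simp_all add: P_def)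
    then show "f h k = j"
      using hk(1) by (simp add: P_def)
  qed
qed

lemma split_large_subset:
  fixes r :: "'a rel" and \<kappa> :: "'k rel"
  assumes r: "Well_order r" and \<kappa>: "Cinfinite \<kappa>" and H: "H \<subseteq> Field r" and large: "\<kappa> <o |H|"
  obtains d where "d \<in> H" "\<kappa> =o |{a \<in> H. (a, d) \<in> r - Id}|" "\<kappa> <o |{b \<in> H. (d, b) \<in> r - Id}|"
proof -
  define s where "s = Restr r H"
  have sH: "well_order_on H s"
    unfolding s_def using r H by (rule well_order_on_Restr)
  then have Fs: "Field s = H" and s: "Well_order s"
    using well_order_on_Well_order by blast+
  have Wk: "Well_order \<kappa>"
    using \<kappa> card_order_on_well_order_on by blast
  \<comment> \<open>The cardinal of \<open>H\<close> is its shortest well-order, so \<open>s\<close>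
    is longer than \<open>\<kappa>\<close>; \<open>d\<close> is then the point whose initial segment
    in \<open>s\<close> is isomorphic to \<open>\<kappa>\<close>.\<close>
  have "\<kappa> <o s"
    using ordLess_ordLeq_trans[OF large card_of_least[OF sH]] .
  then obtain d where d: "d \<in> H" and iso: "\<kappa> =o Restr s (underS s d)"
    using ordLess_iff_ordIso_Restr[OF s Wk] Fs by blast
  define A where "A = {a \<in> H. (a, d) \<in> r - Id}"
  define B where "B = {b \<in> H. (d, b) \<in> r - Id}"
  have "underS s d = A"
    unfolding underS_def s_def A_def using d by blast
  moreover have "Field (Restr s (underS s d)) = underS s d"
    using s by (simp add: Field_Restr_ofilter wo_rel.intro wo_rel.underS_ofilter)
  ultimately have "|Field \<kappa>| =o |A|"
    using card_of_cong[OF iso] by simp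
  then have A: "\<kappa> =o |A|"
    using ordIso_transitive[OF ordIso_symmetric[OF card_of_Field_ordIso]] \<kappa> by blast
  have "\<kappa> <o |B|"
  proof (rule ccontr)
    assume "\<not> \<kappa> <o |B|"
    then have "|B| \<le>o \<kappa>"
      using not_Cinfinite_less_iff[OF \<kappa>] by blast
    moreover have "|A| \<le>o \<kappa>"
      using ordIso_imp_ordLeq[OF ordIso_symmetric[OF A]] .
    moreover have "|{d}| \<le>o \<kappa>"
    proof -
      have "Field \<kappa> \<noteq> {}"
        using \<kappa> unfolding cinfinite_def by auto
      then show ?thesis
        using \<kappa> by (intro ordLeq_ordIso_trans[OF card_of_singl_ordLeq card_of_Field_ordIso]) auto
    qed
    ultimately have "|A \<union> (B \<union> {d})| \<le>o \<kappa>"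
      using \<kappa> by (intro Un_Cinfinite_bound) auto
    moreover have "H = A \<union> (B \<union> {d})"
      unfolding A_def B_def using strict_cases[OF r, of _ d] H d by auto
    ultimately show False
      using not_ordLess_ordLeq[OF large] by simp
  qed
  then show thesis
    using that d A unfolding A_def B_def by blast
qed

section \<open>Construction of the monochromatic matrix\<close>

theorem theorem2p3:
  fixes \<kappa> :: "'k rel" and G :: "('g, 'm) monoid_scheme"
  assumes "Card_order \<kappa>" and "infinite (Field \<kappa>)"
    and "comm_group G"
    and "|carrier G| =o cardSuc (ctwo ^c \<kappa>)"
  shows "FS_matrix_arrow G \<kappa> 2 \<kappa>"
  unfolding FS_matrix_arrow_def
proof (intro ballI)
  fix c assume c: "c \<in> carrier G \<rightarrow> Field \<kappa>"
  interpret comm_group G by fact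
  have \<kappa>: "Cinfinite \<kappa>"
    using assms by (simp add: cinfinite_def)
  define r where "r = |carrier G|"
  have r: "Well_order r" and Fr: "Field r = carrier G"
    unfolding r_def by (rule card_of_Well_order, rule Field_card_of)
  have "ctwo ^c \<kappa> <o |Field r|"
    using ordLess_ordIso_trans[OF cardSuc_greater[OF Card_order_cexp] ordIso_symmetric[OF assms(4)]]
    unfolding Fr .
  moreover have "c (g \<otimes>\<^bsub>G\<^esub> inv\<^bsub>G\<^esub> h) \<in> Field \<kappa>" if "h \<in> Field r" "g \<in> Field r" for h g
    using c that unfolding Fr by auto
  ultimately obtain H j where H: "H \<subseteq> carrier G" and j: "j \<in> Field \<kappa>" and big: "\<kappa> <o |H|"
    and hom: "\<And>h g. h \<in> H \<Longrightarrow> g \<in> H \<Longrightarrow> (h, g) \<in> r - Id \<Longrightarrow> c (g \<otimes>\<^bsub>G\<^esub> inv\<^bsub>G\<^esub> h) = j"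
    using Erdos_Rado_pairs[where f = "\<lambda>h g. c (g \<otimes>\<^bsub>G\<^esub> inv\<^bsub>G\<^esub> h)", OF r \<kappa>] unfolding Fr by blast
  obtain d where d: "d \<in> H" and A: "\<kappa> =o |{a \<in> H. (a, d) \<in> r - Id}|"
    and B: "\<kappa> <o |{b \<in> H. (d, b) \<in> r - Id}|"
    using split_large_subset[OF r \<kappa> _ big] H unfolding Fr by blast
  define A where "A = {a \<in> H. (a, d) \<in> r - Id}"
  define B where "B = {b \<in> H. (d, b) \<in> r - Id}"
  have k: "|Field \<kappa>| =o \<kappa>"
    using assms(1) by (rule card_of_Field_ordIso)
  have AG: "A \<subseteq> carrier G" and BG: "B \<subseteq> carrier G" and dG: "d \<in> carrier G"
    using H d unfolding A_def B_def by auto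
  define X where "X = (\<lambda>a. d \<otimes>\<^bsub>G\<^esub> inv\<^bsub>G\<^esub> a) ` A"
  \<comment> \<open>This discards each \<open>b\<close> whose entry would collide with column 0. The
    discarded elements inject into \<open>X\<close>, of size at most \<open>\<kappa>\<close>, so
    more than \<open>\<kappa>\<close> remain.\<close>
  define B' where "B' = {b \<in> B. b \<otimes>\<^bsub>G\<^esub> inv\<^bsub>G\<^esub> d \<notin> X}"
  have "\<kappa> <o |B'|"
  proof (rule ccontr)
    assume "\<not> \<kappa> <o |B'|"
    then have "|B'| \<le>o \<kappa>"
      using not_Cinfinite_less_iff[OF \<kappa>] by blast
    moreover have "|B - B'| \<le>o \<kappa>"
    proof -
      have "inj_on (\<lambda>b. b \<otimes>\<^bsub>G\<^esub> inv\<^bsub>G\<^esub> d) (B - B')"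
        using BG dG by (intro inj_onI) (simp add: subset_iff)
      moreover have "(\<lambda>b. b \<otimes>\<^bsub>G\<^esub> inv\<^bsub>G\<^esub> d) ` (B - B') \<subseteq> X"
        unfolding B'_def by auto
      ultimately have "|B - B'| \<le>o |X|"
        using card_of_ordLeq by blast
      also have "|X| \<le>o |A|"
        unfolding X_def by (rule card_of_image)
      also have "|A| =o \<kappa>"
        using A unfolding A_def by (rule ordIso_symmetric)
      finally show ?thesis .
    qed
    ultimately have "|B' \<union> (B - B')| \<le>o \<kappa>"
      using \<kappa> by (intro Un_Cinfinite_bound)
    moreover have "B' \<union> (B - B') = B"
      unfolding B'_def by blast
    ultimately show False
      using not_ordLess_ordLeq[OF B] unfolding B_def by simp
  qed
  then have "|Field \<kappa>| \<le>o |B'|"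
    using ordIso_ordLeq_trans[OF k ordLess_imp_ordLeq] by blast
  then obtain v where v: "inj_on v (Field \<kappa>)" "v ` Field \<kappa> \<subseteq> B'"
    using card_of_ordLeq by metis
  have "|Field \<kappa>| \<le>o |A|"
    using ordIso_imp_ordLeq[OF ordIso_transitive[OF k A]] unfolding A_def .
  then obtain u where u: "inj_on u (Field \<kappa>)" "u ` Field \<kappa> \<subseteq> A"
    using card_of_ordLeq by metis
  have uA: "u \<alpha> \<in> A" and vB': "v \<alpha> \<in> B'" and uG: "u \<alpha> \<in> carrier G" and vG: "v \<alpha> \<in> carrier G"
    if "\<alpha> \<in> Field \<kappa>" for \<alpha>
    using that u(2) v(2) AG BG unfolding B'_def by blast+
  define x where "x \<alpha> i = (if i = 0 then d \<otimes>\<^bsub>G\<^esub> inv\<^bsub>G\<^esub> u \<alpha> else v \<alpha> \<otimes>\<^bsub>G\<^esub> inv\<^bsub>G\<^esub> d)"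
    for \<alpha> and i :: nat
  have xG: "\<forall>\<alpha>\<in>Field \<kappa>. \<forall>i<2. x \<alpha> i \<in> carrier G"
    unfolding x_def using dG uG vG by simp
  have ne: "d \<otimes>\<^bsub>G\<^esub> inv\<^bsub>G\<^esub> u \<alpha> \<noteq> v \<beta> \<otimes>\<^bsub>G\<^esub> inv\<^bsub>G\<^esub> d"
    if "\<alpha> \<in> Field \<kappa>" "\<beta> \<in> Field \<kappa>" for \<alpha> \<beta>
    using uA[OF that(1)] vB'[OF that(2)] unfolding B'_def X_def by force
  have inj0: "\<alpha> = \<beta>" if "d \<otimes>\<^bsub>G\<^esub> inv\<^bsub>G\<^esub> u \<alpha> = d \<otimes>\<^bsub>G\<^esub> inv\<^bsub>G\<^esub> u \<beta>"
    "\<alpha> \<in> Field \<kappa>" "\<beta> \<in> Field \<kappa>" for \<alpha> \<beta>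
  proof -
    have "inv\<^bsub>G\<^esub> u \<alpha> = inv\<^bsub>G\<^esub> u \<beta>"
      using that dG uG by simp
    then have "u \<alpha> = u \<beta>"
      using uG[OF that(2)] uG[OF that(3)] by (metis inv_inv)
    then show ?thesis
      using u(1) that(2,3) by (simp add: inj_on_eq_iff)
  qed
  have inj1: "\<alpha> = \<beta>" if "v \<alpha> \<otimes>\<^bsub>G\<^esub> inv\<^bsub>G\<^esub> d = v \<beta> \<otimes>\<^bsub>G\<^esub> inv\<^bsub>G\<^esub> d"
    "\<alpha> \<in> Field \<kappa>" "\<beta> \<in> Field \<kappa>" for \<alpha> \<beta>
    using that dG vG v(1) by (simp add: inj_on_eq_iff)
  have distinct: "inj_on (\<lambda>(\<alpha>, i). x \<alpha> i) (Field \<kappa> \<times> {..<2})"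
  proof (rule inj_onI)
    fix p q assume "p \<in> Field \<kappa> \<times> {..<2::nat}" "q \<in> Field \<kappa> \<times> {..<2::nat}"
      and eq: "(case p of (\<alpha>, i) \<Rightarrow> x \<alpha> i) = (case q of (\<alpha>, i) \<Rightarrow> x \<alpha> i)"
    then obtain \<alpha> i \<beta> i' where pq: "p = (\<alpha>, i)" "q = (\<beta>, i')" "\<alpha> \<in> Field \<kappa>" "\<beta> \<in> Field \<kappa>"
      "i < 2" "i' < 2"
      by auto
    have "i = i'"
      using eq pq ne[of \<alpha> \<beta>] ne[of \<beta> \<alpha>] unfolding x_def by (auto split: if_splits)
    moreover have "\<alpha> = \<beta>"
      using eq pq \<open>i = i'\<close> inj0[of \<alpha> \<beta>] inj1[of \<alpha> \<beta>] unfolding x_def by (auto split: if_splits)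
    ultimately show "p = q"
      using pq by simp
  qed
  have lt: "(u \<alpha>, d) \<in> r - Id" "(d, v \<alpha>) \<in> r - Id" "u \<alpha> \<in> H" "v \<alpha> \<in> H" if "\<alpha> \<in> Field \<kappa>" for \<alpha>
    using uA[OF that] vB'[OF that] unfolding A_def B'_def B_def by auto
  have telescope: "x \<alpha> 0 \<otimes>\<^bsub>G\<^esub> x \<beta> 1 = v \<beta> \<otimes>\<^bsub>G\<^esub> inv\<^bsub>G\<^esub> u \<alpha>"
    if "\<alpha> \<in> Field \<kappa>" "\<beta> \<in> Field \<kappa>" for \<alpha> \<beta>
  proof -
    have "x \<alpha> 0 \<otimes>\<^bsub>G\<^esub> x \<beta> 1 = (v \<beta> \<otimes>\<^bsub>G\<^esub> inv\<^bsub>G\<^esub> d) \<otimes>\<^bsub>G\<^esub> (d \<otimes>\<^bsub>G\<^esub> inv\<^bsub>G\<^esub> u \<alpha>)"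
      unfolding x_def using dG uG[OF that(1)] vG[OF that(2)] by (simp add: m_comm)
    moreover have "inv\<^bsub>G\<^esub> d \<otimes>\<^bsub>G\<^esub> (d \<otimes>\<^bsub>G\<^esub> inv\<^bsub>G\<^esub> u \<alpha>) = inv\<^bsub>G\<^esub> u \<alpha>"
      using dG uG[OF that(1)] by (simp flip: m_assoc)
    ultimately show ?thesis
      using dG uG[OF that(1)] vG[OF that(2)] by (simp add: m_assoc)
  qed
  have mono: "c s = j" if s: "s \<in> FS_matrix G \<kappa> 2 x" for s
  proof -
    \<comment> \<open>The three kinds of sums are the differences of the increasing pairs
      \<open>(u \<alpha>, d)\<close>, \<open>(d, v \<alpha>)\<close> and
      \<open>(u \<alpha>, v \<beta>)\<close> of \<open>H\<close>, all of colour
      \<open>j\<close>.\<close>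
    consider \<alpha> where "\<alpha> \<in> Field \<kappa>" "s = x \<alpha> 0" | \<alpha> where "\<alpha> \<in> Field \<kappa>" "s = x \<alpha> 1"
      | \<alpha> \<beta> where "\<alpha> \<in> Field \<kappa>" "\<beta> \<in> Field \<kappa>" "s = x \<alpha> 0 \<otimes>\<^bsub>G\<^esub> x \<beta> 1"
      using s unfolding FS_matrix_two[OF assms(3) xG] by blast
    then show ?thesis
    proof cases
      case (1 \<alpha>)
      then show ?thesis using hom d lt[of \<alpha>] by (simp add: x_def)
    next
      case (2 \<alpha>)
      then show ?thesis using hom d lt[of \<alpha>] by (simp add: x_def)
    next
      case (3 \<alpha> \<beta>)
      then show ?thesis
        using hom lt telescope strict_trans[OF r] by metis
    qed
  qed
  show "\<exists>x. (\<forall>\<alpha>\<in>Field \<kappa>. \<forall>i<2. x \<alpha> i \<in> carrier G) \<and>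
      inj_on (\<lambda>(\<alpha>, i). x \<alpha> i) (Field \<kappa> \<times> {..<2}) \<and>
      (\<exists>j\<in>Field \<kappa>. \<forall>s\<in>FS_matrix G \<kappa> 2 x. c s = j)"
    using xG distinct j mono by blast
qed

end
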